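(* Let $C_1,C_2,C_3\ge 0$ with $C_1+C_2+C_3=1$, let $\Omega\subset\mathbb{R}^n$ be a region, let $\mathcal{X}_k\subset\mathbb{R}^n$ be a finite interpolation set, let $m_{k-1}\in\mathcal{Q}$, and let the objective function $f:\mathbb{R}^n\to\mathbb{R}$ be quadratic, i.e. $f\in\mathcal{Q}$. If $m_k$ is the solution of $$\min_{m\in\mathcal{Q}}\left\{\sum_{i=1}^{3}C_i\,|m-m_{k-1}|^2_{H^{i-1}(\Omega)}\ :\ m(\boldsymbol{x})=f(\boldsymbol{x})\ \text{ for all } \boldsymbol{x}\in\mathcal{X}_k\right\},$$ then $$\sum_{i=1}^{3}C_i\,|m_k-f|^2_{H^{i-1}(\Omega)}\ \le\ \sum_{i=1}^{3}C_i\,|m_{k-1}-f|^2_{H^{i-1}(\Omega)}.$$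
   Context: $\mathcal{Q}$ denotes the space of real polynomials on $\mathbb{R}^n$ of total degree at most two. The quadratic $m_{k-1}$ is the model from the previous iteration of a model-based method, and $\mathcal{X}_k$ is the interpolation set at the current iteration. For a function $u$ that is twice continuously differentiable on $\Omega$, define $$|u|_{H^0(\Omega)}=\left(\int_\Omega |u(\boldsymbol{x})|^2\,d\boldsymbol{x}\right)^{1/2},\quad |u|_{H^1(\Omega)}=\left(\int_\Omega \|\nabla u(\boldsymbol{x})\|_2^2\,d\boldsymbol{x}\right)^{1/2},\quad |u|_{H^2(\Omega)}=\left(\int_\Omega \|\nabla^2 u(\boldsymbol{x})\|_F^2\,d\boldsymbol{x}\right)^{1/2},$$ where $\|\cdot\|_F$ is the Frobenius norm. *)

theory Defs
  imports "HOL-Analysis.Analysis"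
begin

text \<open>Real polynomials on \<open>\<real>\<^sup>n\<close> of total degree at most \<open>d\<close>, as functions; the
  functions \<open>\<alpha> :: 'n \<Rightarrow> nat\<close> are the multi-indices.\<close>

definition polys_deg_le :: "nat \<Rightarrow> (real ^ 'n \<Rightarrow> real) set" where
  "polys_deg_le d =
     {p. \<exists>a :: ('n \<Rightarrow> nat) \<Rightarrow> real.
           \<forall>x. p x = (\<Sum>\<alpha> | (\<Sum>i\<in>UNIV. \<alpha> i) \<le> d. a \<alpha> * (\<Prod>i\<in>UNIV. (x $ i) ^ \<alpha> i))}"

abbreviation quadratics :: "(real ^ 'n \<Rightarrow> real) set" where
  "quadratics \<equiv> polys_deg_le 2"

text \<open>A region is a domain (nonempty, open, connected) together with none, some or all of its
  boundary points, so that both open domains and closed balls are regions. Measurability is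
  required because the added part of the boundary may be an arbitrary set.\<close>

definition region :: "(real ^ 'n) set \<Rightarrow> bool" where
  "region \<Omega> \<longleftrightarrow> \<Omega> \<in> sets lebesgue \<and>
     (\<exists>U. open U \<and> connected U \<and> U \<noteq> {} \<and> U \<subseteq> \<Omega> \<and> \<Omega> \<subseteq> closure U)"

definition grad :: "(real ^ 'n \<Rightarrow> real) \<Rightarrow> real ^ 'n \<Rightarrow> real ^ 'n" where
  "grad u x = (THE D. GDERIV u x :> D)"

definition hessian :: "(real ^ 'n \<Rightarrow> real) \<Rightarrow> real ^ 'n \<Rightarrow> real ^ 'n ^ 'n" where
  "hessian u x = jacobian (grad u) (at x)"

definition ennreal_sqrt :: "ennreal \<Rightarrow> ennreal" where
  "ennreal_sqrt a = (if a = \<infinity> then \<infinity> else ennreal (sqrt (enn2real a)))"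

text \<open>The seminorms take values in \<open>[0, \<infinity>]\<close>: a region need not be bounded, and the integrals
  may then diverge. The library norm on \<open>real ^ 'n\<close> is the Euclidean norm, and the one on
  \<open>real ^ 'n ^ 'n\<close> is the Frobenius norm.\<close>

definition H0_seminorm :: "(real ^ 'n) set \<Rightarrow> (real ^ 'n \<Rightarrow> real) \<Rightarrow> ennreal" where
  "H0_seminorm \<Omega> u = ennreal_sqrt (\<integral>\<^sup>+x\<in>\<Omega>. ennreal (\<bar>u x\<bar>\<^sup>2) \<partial>lebesgue)"

definition H1_seminorm :: "(real ^ 'n) set \<Rightarrow> (real ^ 'n \<Rightarrow> real) \<Rightarrow> ennreal" where
  "H1_seminorm \<Omega> u = ennreal_sqrt (\<integral>\<^sup>+x\<in>\<Omega>. ennreal ((norm (grad u x))\<^sup>2) \<partial>lebesgue)"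

definition H2_seminorm :: "(real ^ 'n) set \<Rightarrow> (real ^ 'n \<Rightarrow> real) \<Rightarrow> ennreal" where
  "H2_seminorm \<Omega> u = ennreal_sqrt (\<integral>\<^sup>+x\<in>\<Omega>. ennreal ((norm (hessian u x))\<^sup>2) \<partial>lebesgue)"

text \<open>Since \<open>0 * \<infinity> = 0\<close> in \<open>ennreal\<close>, a term with zero weight is absent from the sum even if
  its seminorm is infinite.\<close>

definition weighted_sq ::
    "real \<Rightarrow> real \<Rightarrow> real \<Rightarrow> (real ^ 'n) set \<Rightarrow> (real ^ 'n \<Rightarrow> real) \<Rightarrow> ennreal" where
  "weighted_sq C1 C2 C3 \<Omega> u =
     ennreal C1 * (H0_seminorm \<Omega> u)\<^sup>2 +
     ennreal C2 * (H1_seminorm \<Omega> u)\<^sup>2 +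
     ennreal C3 * (H2_seminorm \<Omega> u)\<^sup>2"

end

theory Submission
  imports Defs
begin

text \<open>The weighted functional \<open>W\<close> is a sum of squared \<open>L\<^sup>2\<close> norms of linear images of its
  argument, so for \<open>0 < t < 1\<close> it satisfies
  \<open>W ((1 - t) u + t v) + t (1 - t) W (v - u) = (1 - t) W u + t W v\<close>. This holds in
  \<open>[0, \<infinity>]\<close>, without any integrability assumption. Take \<open>u = m\<^sub>k - m\<^sub>k\<^sub>-\<^sub>1\<close> and
  \<open>v = f - m\<^sub>k\<^sub>-\<^sub>1\<close>: the feasible set is convex and contains \<open>f\<close>, so \<open>W u \<le> W ((1 - t) u + t v)\<close>,
  whence \<open>(1 - t) W (v - u) \<le> W v\<close>, and \<open>t \<rightarrow> 0\<close> gives the claim.\<close>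

section \<open>Twice continuously differentiable functions\<close>

text \<open>The gradient \<open>G\<close> and its derivative \<open>H\<close> are carried as
  explicit witnesses, because \<open>grad\<close> and \<open>hessian\<close> rest on choice
  operators and say nothing until a derivative is exhibited. Continuity of \<open>H\<close> is
  stated direction by direction, which is how matrix entries see it.\<close>

definition C2_with ::
    "(real ^ 'n \<Rightarrow> real) \<Rightarrow> (real ^ 'n \<Rightarrow> real ^ 'n) \<Rightarrow> (real ^ 'n \<Rightarrow> real ^ 'n \<Rightarrow> real ^ 'n) \<Rightarrow> bool"
  where
  "C2_with u G H \<longleftrightarrow> (\<forall>x. GDERIV u x :> G x) \<and> (\<forall>x. (G has_derivative H x) (at x)) \<and>
     (\<forall>h. continuous_on UNIV (\<lambda>x. H x h))"

lemma C2_withD: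
  assumes "C2_with u G H"
  shows "GDERIV u x :> G x" "(u has_derivative (\<lambda>h. h \<bullet> G x)) (at x)"
    "(G has_derivative H x) (at x)" "continuous_on UNIV (\<lambda>x. H x h)"
    "continuous_on UNIV u" "continuous_on UNIV G"
proof -
  show u: "(u has_derivative (\<lambda>h. h \<bullet> G x)) (at x)" for x
    using assms by (simp add: C2_with_def gderiv_def)
  show G: "(G has_derivative H x) (at x)" for x
    using assms by (simp add: C2_with_def)
  show "continuous_on UNIV u" "continuous_on UNIV G"
    using u G by (meson continuous_at_imp_continuous_on has_derivative_continuous)+
qed (use assms in \<open>simp_all add: C2_with_def\<close>)

lemma C2_with_const: "C2_with (\<lambda>x. c) (\<lambda>x. 0) (\<lambda>x h. 0)"
  by (simp add: C2_with_def gderiv_def)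

lemma C2_with_component:
  fixes i :: "'n::finite"
  shows "C2_with (\<lambda>x. x $ i) (\<lambda>x. axis i 1) (\<lambda>x h. 0)"
proof -
  have "((\<lambda>x. x $ i) has_derivative (\<lambda>h. h \<bullet> axis i 1)) (at x)" for x :: "real ^ 'n"
    by (simp add: inner_axis bounded_linear_imp_has_derivative bounded_linear_vec_nth)
  then show ?thesis
    by (simp add: C2_with_def gderiv_def)
qed

lemma C2_with_lincomb:
  assumes "C2_with u G H" "C2_with v K L"
  shows "C2_with (\<lambda>x. a * u x + b * v x) (\<lambda>x. a *\<^sub>R G x + b *\<^sub>R K x)
           (\<lambda>x h. a *\<^sub>R H x h + b *\<^sub>R L x h)"
  unfolding C2_with_def gderiv_def
proof (intro conjI allI)
  note u = C2_withD[OF assms(1)] and v = C2_withD[OF assms(2)]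
  show "((\<lambda>x. a * u x + b * v x) has_derivative (\<lambda>h. h \<bullet> (a *\<^sub>R G x + b *\<^sub>R K x))) (at x)" for x
    using has_derivative_add[OF has_derivative_mult_right[OF u(2)] has_derivative_mult_right[OF v(2)]]
    by (simp add: inner_add_right)
  show "((\<lambda>x. a *\<^sub>R G x + b *\<^sub>R K x) has_derivative (\<lambda>h. a *\<^sub>R H x h + b *\<^sub>R L x h)) (at x)" for x
    by (intro derivative_intros u(3) v(3))
  show "continuous_on UNIV (\<lambda>x. a *\<^sub>R H x h + b *\<^sub>R L x h)" for h
    by (intro continuous_intros u(4) v(4))
qed

lemma C2_with_mult:
  assumes "C2_with u G H" "C2_with v K L"
  shows "C2_with (\<lambda>x. u x * v x) (\<lambda>x. u x *\<^sub>R K x + v x *\<^sub>R G x)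
           (\<lambda>x h. u x *\<^sub>R L x h + (h \<bullet> G x) *\<^sub>R K x + (v x *\<^sub>R H x h + (h \<bullet> K x) *\<^sub>R G x))"
  unfolding C2_with_def gderiv_def
proof (intro conjI allI)
  note u = C2_withD[OF assms(1)] and v = C2_withD[OF assms(2)]
  show "((\<lambda>x. u x * v x) has_derivative (\<lambda>h. h \<bullet> (u x *\<^sub>R K x + v x *\<^sub>R G x))) (at x)" for x
    using has_derivative_mult[OF u(2) v(2)] by (simp add: inner_add_right ac_simps)
  show "((\<lambda>x. u x *\<^sub>R K x + v x *\<^sub>R G x) has_derivative
      (\<lambda>h. u x *\<^sub>R L x h + (h \<bullet> G x) *\<^sub>R K x + (v x *\<^sub>R H x h + (h \<bullet> K x) *\<^sub>R G x))) (at x)" for x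
    by (intro derivative_intros u(2,3) v(2,3))
  show "continuous_on UNIV
      (\<lambda>x. u x *\<^sub>R L x h + (h \<bullet> G x) *\<^sub>R K x + (v x *\<^sub>R H x h + (h \<bullet> K x) *\<^sub>R G x))" for h
    by (intro continuous_intros u(4-6) v(4-6))
qed

text \<open>The derivative at a point is unique, and a vector is determined by its inner products
  with all \<open>h\<close>; hence the description in \<open>grad\<close> picks out
  \<open>G x\<close>.\<close>

lemma grad_C2_with:
  assumes "C2_with u G H"
  shows "grad u = G"
proof
  fix x
  have "D = G x" if "GDERIV u x :> D" for D
    using has_derivative_unique[OF that[unfolded gderiv_def] C2_withD(2)[OF assms]]
    by (metis vector_eq_ldot)
  then show "grad u x = G x"
    unfolding grad_def using C2_withD(1)[OF assms] by blast
qed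

lemma hessian_C2_with:
  assumes "C2_with u G H"
  shows "hessian u = (\<lambda>x. matrix (H x))"
proof
  fix x
  have "H x = frechet_derivative G (at x)"
    by (rule frechet_derivative_at[OF C2_withD(3)[OF assms]])
  then show "hessian u x = matrix (H x)"
    by (simp add: hessian_def jacobian_def grad_C2_with[OF assms])
qed

text \<open>Hiding the witnesses lets inductions over powers, products and sums proceed without
  tracking derivative formulas.\<close>

definition is_C2 :: "(real ^ 'n \<Rightarrow> real) \<Rightarrow> bool" where
  "is_C2 u \<longleftrightarrow> (\<exists>G H. C2_with u G H)"

section \<open>Closure of \<open>is_C2\<close> under algebraic operations, and polynomials\<close>

lemma C2_const: "is_C2 (\<lambda>x. c)"
  using C2_with_const is_C2_def by blast

lemma C2_component: "is_C2 (\<lambda>x. x $ i)"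
  using C2_with_component is_C2_def by blast

lemma C2_lincomb: "is_C2 u \<Longrightarrow> is_C2 v \<Longrightarrow> is_C2 (\<lambda>x. a * u x + b * v x)"
  unfolding is_C2_def using C2_with_lincomb by blast

lemma C2_mult: "is_C2 u \<Longrightarrow> is_C2 v \<Longrightarrow> is_C2 (\<lambda>x. u x * v x)"
  unfolding is_C2_def using C2_with_mult by blast

lemma C2_power: "is_C2 u \<Longrightarrow> is_C2 (\<lambda>x. u x ^ k)"
  by (induction k) (auto intro: C2_const C2_mult)

lemma C2_prod: "(\<And>i. i \<in> I \<Longrightarrow> is_C2 (u i)) \<Longrightarrow> is_C2 (\<lambda>x. \<Prod>i\<in>I. u i x)"
  by (induction I rule: infinite_finite_induct) (auto intro: C2_const C2_mult)

text \<open>A sum over an infinite set is 0 by default, hence constant, so the set of multi-indices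
  may be used without a finiteness proof.\<close>

lemma C2_sum: "(\<And>i. i \<in> I \<Longrightarrow> is_C2 (u i)) \<Longrightarrow> is_C2 (\<lambda>x. \<Sum>i\<in>I. u i x)"
proof (induction I rule: infinite_finite_induct)
  case (insert i I)
  then show ?case
    using C2_lincomb[of "u i" "\<lambda>x. \<Sum>i\<in>I. u i x" 1 1] by simp
qed (auto intro: C2_const)

lemma C2_polys_deg_le:
  assumes "p \<in> polys_deg_le d"
  shows "is_C2 p"
proof -
  obtain a where "p = (\<lambda>x. \<Sum>\<alpha> | (\<Sum>i\<in>UNIV. \<alpha> i) \<le> d. a \<alpha> * (\<Prod>i\<in>UNIV. (x $ i) ^ \<alpha> i))"
    using assms unfolding polys_deg_le_def by auto
  then show ?thesis
    by (auto intro!: C2_sum C2_mult C2_const C2_prod C2_power C2_component)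
qed

section \<open>Continuity and linearity of gradient and Hessian\<close>

lemma continuous_grad:
  assumes "is_C2 u"
  shows "continuous_on UNIV (grad u)"
  using assms C2_withD(6) grad_C2_with unfolding is_C2_def by metis

lemma continuous_hessian:
  assumes "is_C2 u"
  shows "continuous_on UNIV (hessian u)"
proof -
  obtain G H where C: "C2_with u G H"
    using assms is_C2_def by blast
  show ?thesis
    \<comment> \<open>The entries of \<open>matrix (H x)\<close> are components of
      \<open>H x\<close> at the unit vectors, so continuity in each fixed direction
      suffices.\<close>
    unfolding hessian_C2_with[OF C] matrix_def
    by (intro continuous_intros C2_withD(4)[OF C])
qed

lemma grad_lincomb:
  assumes "is_C2 u" "is_C2 v"
  shows "grad (\<lambda>x. a * u x + b * v x) x = a *\<^sub>R grad u x + b *\<^sub>R grad v x"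
proof -
  obtain G H K L where C: "C2_with u G H" "C2_with v K L"
    using assms is_C2_def by blast
  show ?thesis
    by (simp add: grad_C2_with[OF C2_with_lincomb[OF C]] C[THEN grad_C2_with])
qed

lemma hessian_lincomb:
  assumes "is_C2 u" "is_C2 v"
  shows "hessian (\<lambda>x. a * u x + b * v x) x = a *\<^sub>R hessian u x + b *\<^sub>R hessian v x"
proof -
  obtain G H K L where C: "C2_with u G H" "C2_with v K L"
    using assms is_C2_def by blast
  show ?thesis
    by (simp add: hessian_C2_with[OF C2_with_lincomb[OF C]] C[THEN hessian_C2_with]
        matrix_def vec_eq_iff)
qed

section \<open>The convexity identity\<close>

text \<open>Covers the value \<infinity> too, so squared seminorms can always be replaced by the
  integrals themselves.\<close>

lemma ennreal_sqrt_squared: "(ennreal_sqrt a)\<^sup>2 = a"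
  by (cases a) (simp_all add: ennreal_sqrt_def ennreal_power)

text \<open>Expanding the inner products, the cross terms
  \<open>2 * t * (1 - t) * (p \<bullet> q)\<close> cancel, and the coefficients of
  \<open>p \<bullet> p\<close> and \<open>q \<bullet> q\<close> collapse to \<open>1 - t\<close> and
  \<open>t\<close>.\<close>

lemma norm_sq_convex_combination:
  fixes p q :: "'a::real_inner"
  shows "(norm ((1 - t) *\<^sub>R p + t *\<^sub>R q))\<^sup>2 + t * (1 - t) * (norm (q - p))\<^sup>2
    = (1 - t) * (norm p)\<^sup>2 + t * (norm q)\<^sup>2"
  unfolding power2_norm_eq_inner
  by (simp add: inner_add_left inner_add_right inner_diff_left inner_diff_right inner_commute)
     algebra

text \<open>The pointwise identity is integrated term by term. Having only nonnegative summands on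
  both sides, with no subtraction of integrals, it survives infinite integrals. The general codomain
  serves values, gradients and Hessians alike.\<close>

lemma nn_integral_norm_sq_convex_combination:
  fixes P Q :: "'a \<Rightarrow> 'b::{real_inner, second_countable_topology}"
  assumes "0 \<le> t" "t \<le> 1" "A \<in> sets M"
    and [measurable]: "P \<in> borel_measurable M" "Q \<in> borel_measurable M"
  shows "(\<integral>\<^sup>+x\<in>A. ennreal ((norm ((1 - t) *\<^sub>R P x + t *\<^sub>R Q x))\<^sup>2) \<partial>M)
      + ennreal (t * (1 - t)) * (\<integral>\<^sup>+x\<in>A. ennreal ((norm (Q x - P x))\<^sup>2) \<partial>M)
    = ennreal (1 - t) * (\<integral>\<^sup>+x\<in>A. ennreal ((norm (P x))\<^sup>2) \<partial>M)
      + ennreal t * (\<integral>\<^sup>+x\<in>A. ennreal ((norm (Q x))\<^sup>2) \<partial>M)"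
proof -
  note [measurable] = assms(3)
  have "ennreal ((norm ((1 - t) *\<^sub>R P x + t *\<^sub>R Q x))\<^sup>2) * indicator A x
        + ennreal (t * (1 - t)) * (ennreal ((norm (Q x - P x))\<^sup>2) * indicator A x)
      = ennreal (1 - t) * (ennreal ((norm (P x))\<^sup>2) * indicator A x)
        + ennreal t * (ennreal ((norm (Q x))\<^sup>2) * indicator A x)" for x
    using assms(1,2) norm_sq_convex_combination[of t "P x" "Q x"]
    by (simp add: ennreal_mult[symmetric] ennreal_plus[symmetric] split: split_indicator
        del: ennreal_plus)
  then show ?thesis
    by (simp add: nn_integral_cmult[symmetric] nn_integral_add[symmetric])
qed

lemma weighted_sq_convex_combination:
  assumes t: "0 \<le> t" "t \<le> 1" and \<Omega>: "\<Omega> \<in> sets lebesgue" and C2: "is_C2 u" "is_C2 v"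
  shows "weighted_sq C1 C2 C3 \<Omega> (\<lambda>x. (1 - t) * u x + t * v x)
      + ennreal (t * (1 - t)) * weighted_sq C1 C2 C3 \<Omega> (\<lambda>x. v x - u x)
    = ennreal (1 - t) * weighted_sq C1 C2 C3 \<Omega> u + ennreal t * weighted_sq C1 C2 C3 \<Omega> v"
    (is "?W + ?s * ?D = ?a * ?U + ?b * ?V")
proof -
  let ?w = "\<lambda>x. (1 - t) * u x + t * v x"
  let ?d = "\<lambda>x. v x - u x"
  \<comment> \<open>Continuity gives Borel measurability, which passes to the completed
    measure.\<close>
  have meas: "F \<in> borel_measurable lebesgue"
    if "continuous_on UNIV F" for F :: "real ^ 'n \<Rightarrow> 'b::topological_space"
    using that by (simp add: borel_measurable_continuous_onI measurable_completion)
  have cont: "continuous_on UNIV u" "continuous_on UNIV v"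
    using C2 C2_withD(5) unfolding is_C2_def by blast+
  have diff: "grad ?d x = grad v x - grad u x" "hessian ?d x = hessian v x - hessian u x" for x
    using grad_lincomb[OF C2(2,1), of 1 "-1"] hessian_lincomb[OF C2(2,1), of 1 "-1"] by simp_all
  have 0: "(H0_seminorm \<Omega> ?w)\<^sup>2 + ?s * (H0_seminorm \<Omega> ?d)\<^sup>2
      = ?a * (H0_seminorm \<Omega> u)\<^sup>2 + ?b * (H0_seminorm \<Omega> v)\<^sup>2"
    using nn_integral_norm_sq_convex_combination[OF t \<Omega> cont[THEN meas]]
    by (simp add: H0_seminorm_def ennreal_sqrt_squared)
  have 1: "(H1_seminorm \<Omega> ?w)\<^sup>2 + ?s * (H1_seminorm \<Omega> ?d)\<^sup>2
      = ?a * (H1_seminorm \<Omega> u)\<^sup>2 + ?b * (H1_seminorm \<Omega> v)\<^sup>2"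
    using nn_integral_norm_sq_convex_combination[OF t \<Omega> C2[THEN continuous_grad, THEN meas]]
    by (simp add: H1_seminorm_def ennreal_sqrt_squared grad_lincomb[OF C2] diff)
  have 2: "(H2_seminorm \<Omega> ?w)\<^sup>2 + ?s * (H2_seminorm \<Omega> ?d)\<^sup>2
      = ?a * (H2_seminorm \<Omega> u)\<^sup>2 + ?b * (H2_seminorm \<Omega> v)\<^sup>2"
    using nn_integral_norm_sq_convex_combination[OF t \<Omega> C2[THEN continuous_hessian, THEN meas]]
    by (simp add: H2_seminorm_def ennreal_sqrt_squared hessian_lincomb[OF C2] diff)
  have "?W + ?s * ?D =
      ennreal C1 * ((H0_seminorm \<Omega> ?w)\<^sup>2 + ?s * (H0_seminorm \<Omega> ?d)\<^sup>2) +
      ennreal C2 * ((H1_seminorm \<Omega> ?w)\<^sup>2 + ?s * (H1_seminorm \<Omega> ?d)\<^sup>2) +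
      ennreal C3 * ((H2_seminorm \<Omega> ?w)\<^sup>2 + ?s * (H2_seminorm \<Omega> ?d)\<^sup>2)"
    by (simp add: weighted_sq_def distrib_left ac_simps)
  also have "\<dots> = ?a * ?U + ?b * ?V"
    unfolding 0 1 2 by (simp add: weighted_sq_def distrib_left ac_simps)
  finally show ?thesis .
qed

text \<open>All three seminorms are even. The convexity identity produces differences of the form
  \<open>f - m\<close>, while the theorem is stated with \<open>m - f\<close>.\<close>

lemma weighted_sq_minus_commute:
  assumes "is_C2 u" "is_C2 v"
  shows "weighted_sq C1 C2 C3 \<Omega> (\<lambda>x. u x - v x) = weighted_sq C1 C2 C3 \<Omega> (\<lambda>x. v x - u x)"
proof -
  have *: "grad (\<lambda>x. u x - v x) x = - grad (\<lambda>x. v x - u x) x"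
    "hessian (\<lambda>x. u x - v x) x = - hessian (\<lambda>x. v x - u x) x" for x
    using grad_lincomb[OF assms, of 1 "-1"] grad_lincomb[OF assms(2,1), of 1 "-1"]
      hessian_lincomb[OF assms, of 1 "-1"] hessian_lincomb[OF assms(2,1), of 1 "-1"]
    by simp_all
  show ?thesis
    unfolding weighted_sq_def H0_seminorm_def H1_seminorm_def H2_seminorm_def
    by (simp add: * abs_minus_commute power2_commute)
qed

section \<open>Convexity of the feasible set and the limit t -> 0\<close>

lemma polys_deg_le_lincomb:
  assumes "p \<in> polys_deg_le d" "q \<in> polys_deg_le d"
  shows "(\<lambda>x. a * p x + b * q x) \<in> polys_deg_le d"
proof -
  obtain c e where
    "\<forall>x. p x = (\<Sum>\<alpha> | (\<Sum>i\<in>UNIV. \<alpha> i) \<le> d. c \<alpha> * (\<Prod>i\<in>UNIV. (x $ i) ^ \<alpha> i))"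
    "\<forall>x. q x = (\<Sum>\<alpha> | (\<Sum>i\<in>UNIV. \<alpha> i) \<le> d. e \<alpha> * (\<Prod>i\<in>UNIV. (x $ i) ^ \<alpha> i))"
    using assms unfolding polys_deg_le_def by auto
  then show ?thesis
    unfolding polys_deg_le_def
    by (auto intro!: exI[of _ "\<lambda>\<alpha>. a * c \<alpha> + b * e \<alpha>"]
        simp: sum_distrib_left sum.distrib distrib_right mult.assoc)
qed

text \<open>For infinite \<open>V\<close> nothing is to be shown. Otherwise all quantities involved
  are finite, so \<open>(1 - t) * U\<close> can be cancelled and the factor \<open>t\<close> divided
  out, leaving \<open>U + (1 - t) * D \<le> V\<close> for all small \<open>t\<close>.\<close>

lemma le_from_convexity_identity:
  fixes U V D :: ennreal and W :: "real \<Rightarrow> ennreal"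
  assumes identity: "\<And>t. 0 < t \<Longrightarrow> t < 1 \<Longrightarrow>
      W t + ennreal (t * (1 - t)) * D = ennreal (1 - t) * U + ennreal t * V"
    and min: "\<And>t. 0 < t \<Longrightarrow> t < 1 \<Longrightarrow> U \<le> W t" and "U \<le> V"
  shows "D \<le> V"
proof (cases V)
  case V: (real v)
  obtain r where U: "U = ennreal r" "0 \<le> r"
    using \<open>U \<le> V\<close> V by (metis ennreal_cases ennreal_less_top leD)
  have le: "ennreal r + ennreal (t * (1 - t)) * D \<le> ennreal ((1 - t) * r + t * v)"
    if t: "0 < t" "t < 1" for t
  proof -
    have "ennreal r + ennreal (t * (1 - t)) * D \<le> W t + ennreal (t * (1 - t)) * D"
      using min[OF t] U by (intro add_right_mono) simp
    also have "\<dots> = ennreal ((1 - t) * r + t * v)"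
      unfolding identity[OF t] using t U V by (simp add: ennreal_mult)
    finally show ?thesis .
  qed
  \<comment> \<open>At \<open>t = 1/2\<close> the coefficient of \<open>D\<close> is 1/4 while the
    right-hand side is finite, which excludes \<open>D = \<infinity>\<close>.\<close>
  obtain e where D: "D = ennreal e" "0 \<le> e"
    using le[of "1 / 2"] by (cases D) (auto simp: ennreal_mult_top top_unique)
  \<comment> \<open>With \<open>s = 1 - t\<close>, the limit becomes s -> 1, the form expected by
    \<open>field_le_mult_one_interval\<close>.\<close>
  have "s * e \<le> v" if s: "0 < s" "s < 1" for s
  proof -
    have "ennreal (r + (1 - s) * s * e) \<le> ennreal (s * r + (1 - s) * v)"
      using le[of "1 - s"] s U D by (simp add: ennreal_mult)
    then have "r + (1 - s) * s * e \<le> s * r + (1 - s) * v"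
      \<comment> \<open>Returning to the reals requires the right-hand side to be nonnegative, as
        \<open>ennreal\<close> truncates negative numbers to 0.\<close>
      by (rule iffD1[OF ennreal_le_iff, rotated]) (use s U V in simp)
    then have "(1 - s) * (s * e + r) \<le> (1 - s) * v"
      by (simp add: algebra_simps)
    \<comment> \<open>Divide by \<open>1 - s > 0\<close> and drop \<open>r \<ge> 0\<close>.\<close>
    then show ?thesis
      using s U by simp
  qed
  then have "e \<le> v"
    by (rule field_le_mult_one_interval)
  then show ?thesis
    using V D by simp
qed simp

theorem theorem1p3:
  fixes C1 C2 C3 :: real
    and \<Omega> :: "(real ^ 'n) set"
    and Xk :: "(real ^ 'n) set"
    and mprev mk f :: "real ^ 'n \<Rightarrow> real"
  assumes "C1 \<ge> 0" and "C2 \<ge> 0" and "C3 \<ge> 0" and "C1 + C2 + C3 = 1"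
    and "region \<Omega>"
    and "finite Xk"
    and "mprev \<in> quadratics"
    and "f \<in> quadratics"
    and "is_arg_min (\<lambda>m. weighted_sq C1 C2 C3 \<Omega> (\<lambda>x. m x - mprev x))
           (\<lambda>m. m \<in> quadratics \<and> (\<forall>x\<in>Xk. m x = f x)) mk"
  shows "weighted_sq C1 C2 C3 \<Omega> (\<lambda>x. mk x - f x)
           \<le> weighted_sq C1 C2 C3 \<Omega> (\<lambda>x. mprev x - f x)"
proof -
  let ?W = "weighted_sq C1 C2 C3 \<Omega>"
  have \<Omega>: "\<Omega> \<in> sets lebesgue"
    using \<open>region \<Omega>\<close> by (simp add: region_def)
  have mk: "mk \<in> quadratics" "\<And>x. x \<in> Xk \<Longrightarrow> mk x = f x"
    and min: "\<And>m. m \<in> quadratics \<Longrightarrow> (\<And>x. x \<in> Xk \<Longrightarrow> m x = f x) \<Longrightarrow>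
      ?W (\<lambda>x. mk x - mprev x) \<le> ?W (\<lambda>x. m x - mprev x)"
    using assms(9) unfolding is_arg_min_linorder by auto
  have C2: "is_C2 mk" "is_C2 f" "is_C2 mprev"
    using mk(1) assms(7,8) C2_polys_deg_le by blast+
  have C2_diff: "is_C2 (\<lambda>x. mk x - mprev x)" "is_C2 (\<lambda>x. f x - mprev x)"
    using C2_lincomb[OF C2(1,3), of 1 "-1"] C2_lincomb[OF C2(2,3), of 1 "-1"] by simp_all
  have "?W (\<lambda>x. f x - mk x) \<le> ?W (\<lambda>x. f x - mprev x)"
  proof (rule le_from_convexity_identity)
    fix t :: real
    assume t: "0 < t" "t < 1"
    show "?W (\<lambda>x. ((1 - t) * mk x + t * f x) - mprev x)
        + ennreal (t * (1 - t)) * ?W (\<lambda>x. f x - mk x)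
      = ennreal (1 - t) * ?W (\<lambda>x. mk x - mprev x) + ennreal t * ?W (\<lambda>x. f x - mprev x)"
      \<comment> \<open>Since the weights \<open>1 - t\<close> and \<open>t\<close> add up to 1,
        \<open>mprev\<close> factors out of the combination; it cancels in the difference of the two
        arguments, leaving \<open>f - mk\<close>.\<close>
      using weighted_sq_convex_combination[OF _ _ \<Omega> C2_diff, of t C1 C2 C3] t
      by (simp add: algebra_simps)
    show "?W (\<lambda>x. mk x - mprev x) \<le> ?W (\<lambda>x. ((1 - t) * mk x + t * f x) - mprev x)"
      \<comment> \<open>On \<open>Xk\<close> both \<open>mk\<close> and \<open>f\<close> take the
        value of \<open>f\<close>, hence so does their convex combination, which is therefore a
        competitor of \<open>mk\<close>.\<close>
      using mk assms(8) by (intro min polys_deg_le_lincomb) (simp_all add: algebra_simps)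
  next
    \<comment> \<open>Being quadratic, \<open>f\<close> itself competes; this makes the minimum
      finite whenever the right-hand side is.\<close>
    show "?W (\<lambda>x. mk x - mprev x) \<le> ?W (\<lambda>x. f x - mprev x)"
      using assms(8) by (intro min) simp_all
  qed
  then show ?thesis
    using weighted_sq_minus_commute[OF C2(1,2)] weighted_sq_minus_commute[OF C2(3,2)] by simp
qed

end
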